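(* Let $\mathbb{I}\in\{\mathbb{Q},\mathbb{R}\}$, $N\ge 1$, and let $\mathbf{m}^+$ be a coherent $2N\times 2N$ DBM over $\overline{\mathbb{I}}=\mathbb{I}\cup\{+\infty\}$ with $\mathcal{D}^+(\mathbf{m}^+)\neq\emptyset$. Then for every $i\in\{0,\ldots,N-1\}$, $$\{\,t\in\mathbb{I}\mid\exists (s_0,\ldots,s_{N-1})\in\mathcal{D}^+(\mathbf{m}^+)\text{ such that }s_i=t\,\}=\Big[-(\mathbf{m}^+)^\bullet_{2i,\,2i+1}/2,\ (\mathbf{m}^+)^\bullet_{2i+1,\,2i}/2\Big],$$ where the right-hand side is an interval of $\mathbb{I}$ whose bounds are included only if they are finite.
   Context: A Difference-Bound Matrix (DBM) is a square matrix with entries in $\overline{\mathbb{I}}=\mathbb{I}\cup\{+\infty\}$, indexed from $0$. For an index $i\in\{0,\ldots,2N-1\}$, $\bar{\imath}$ denotes $i\oplus 1$ (bitwise exclusive or), i.e. $\overline{2k}=2k+1$ and $\overline{2k+1}=2k$. A $2N\times 2N$ DBM $\mathbf{m}^+$ is coherent if $\mathbf{m}^+_{ij}=\mathbf{m}^+_{\bar{\jmath}\,\bar{\imath}}$ for all $i,j$. $\mathcal{D}(\mathbf{m}^+)=\{(s_0,\ldots,s_{2N-1})\in\mathbb{I}^{2N}\mid\forall i,j,\ s_j-s_i\le\mathbf{m}^+_{ij}\}$ and $\mathcal{D}^+(\mathbf{m}^+)=\{(s_0,\ldots,s_{N-1})\in\mathbb{I}^N\mid (s_0,-s_0,\ldots,s_{N-1},-s_{N-1})\in\mathcal{D}(\mathbf{m}^+)\}$.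 The strong closure $(\mathbf{m}^+)^\bullet$ is the output of the following algorithm: $\mathbf{m}^+_0=\mathbf{m}^+$, $\mathbf{m}^+_{k+1}=S^+(C^+_{2k}(\mathbf{m}^+_k))$ for $0\le k<N$, and $(\mathbf{m}^+)^\bullet=\mathbf{m}^+_N$, where $[C^+_k(\mathbf{n})]_{ii}=0$; for $i\ne j$, $$[C^+_k(\mathbf{n})]_{ij}=\min\big(\mathbf{n}_{ij},\ \mathbf{n}_{ik}+\mathbf{n}_{kj},\ \mathbf{n}_{i\bar{k}}+\mathbf{n}_{\bar{k}j},\ \mathbf{n}_{ik}+\mathbf{n}_{k\bar{k}}+\mathbf{n}_{\bar{k}j},\ \mathbf{n}_{i\bar{k}}+\mathbf{n}_{\bar{k}k}+\mathbf{n}_{kj}\big);$$ and $[S^+(\mathbf{n})]_{ij}=\min\big(\mathbf{n}_{ij},\ (\mathbf{n}_{i\bar{\imath}}+\mathbf{n}_{\bar{\jmath}j})/2\big)$ for all $i,j$. *)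

theory Defs
  imports "HOL-Library.Extended_Real" "HOL-Library.FuncSet"
begin

text \<open>
  The scalar domain is a set \<open>I\<close> of reals, to be instantiated with \<open>\<rat>\<close> or \<open>\<real>\<close>.
  A matrix is a function on pairs of naturals of which only the entries with indices
  below its size are meaningful. Entries are extended reals restricted to \<open>I \<union> {\<infinity>}\<close>;
  \<open>-\<infinity>\<close> is excluded, so sums of entries never hit the convention for \<open>\<infinity> + -\<infinity>\<close>.
\<close>

type_synonym ematrix = "nat \<Rightarrow> nat \<Rightarrow> ereal"

definition dbm :: "real set \<Rightarrow> nat \<Rightarrow> ematrix \<Rightarrow> bool" where
  "dbm I n m \<longleftrightarrow> (\<forall>i<n. \<forall>j<n. m i j \<in> ereal ` I \<union> {\<infinity>})"

definition bar :: "nat \<Rightarrow> nat" where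
  "bar i = xor i 1"

definition coherent :: "nat \<Rightarrow> ematrix \<Rightarrow> bool" where
  "coherent N m \<longleftrightarrow> (\<forall>i<2*N. \<forall>j<2*N. m i j = m (bar j) (bar i))"

text \<open>
  Tuples of length \<open>n\<close> over \<open>I\<close> are the elements of \<open>{..<n} \<rightarrow>\<^sub>E I\<close>.
\<close>

definition dbm_dom :: "real set \<Rightarrow> nat \<Rightarrow> ematrix \<Rightarrow> (nat \<Rightarrow> real) set" where
  "dbm_dom I n m = {s \<in> {..<n} \<rightarrow>\<^sub>E I. \<forall>i<n. \<forall>j<n. ereal (s j - s i) \<le> m i j}"

text \<open>The tuple \<open>(s 0, - s 0, \<dots>, s (N - 1), - s (N - 1))\<close>.\<close>

definition signed_double :: "nat \<Rightarrow> (nat \<Rightarrow> real) \<Rightarrow> nat \<Rightarrow> real" where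
  "signed_double N s =
     (\<lambda>i\<in>{..<2*N}. if even i then s (i div 2) else - s (i div 2))"

definition oct_dom :: "real set \<Rightarrow> nat \<Rightarrow> ematrix \<Rightarrow> (nat \<Rightarrow> real) set" where
  "oct_dom I N m = {s \<in> {..<N} \<rightarrow>\<^sub>E I. signed_double N s \<in> dbm_dom I (2*N) m}"

definition C_step :: "nat \<Rightarrow> ematrix \<Rightarrow> ematrix" where
  "C_step k n = (\<lambda>i j.
     if i = j then 0
     else Min {n i j,
               n i k + n k j,
               n i (bar k) + n (bar k) j,
               n i k + n k (bar k) + n (bar k) j,
               n i (bar k) + n (bar k) k + n k j})"

definition S_step :: "ematrix \<Rightarrow> ematrix" where
  "S_step n = (\<lambda>i j. min (n i j) ((n i (bar i) + n (bar j) j) / 2))"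

primrec closure_iter :: "ematrix \<Rightarrow> nat \<Rightarrow> ematrix" where
  "closure_iter m 0 = m"
| "closure_iter m (Suc k) = S_step (C_step (2*k) (closure_iter m k))"

definition strong_closure :: "nat \<Rightarrow> ematrix \<Rightarrow> ematrix" where
  "strong_closure N m = closure_iter m N"

end

theory Submission
  imports Defs
begin

text \<open>
  Soundness of the closure gives one inclusion. For the other, discarding the strengthening steps
  only enlarges the entries, so off the diagonal the strong closure lies below the shortest-path
  (Floyd--Warshall) closure \<open>c\<close> of the matrix. Hence an admissible \<open>t\<close> satisfies
  \<open>-c a b \<le> 2 * t \<le> c b a\<close> for \<open>a = 2 * i\<close>, \<open>b = 2 * i + 1\<close>, and a given potential \<open>v\<close> of \<open>c\<close> can be
  modified to a potential \<open>x\<close> with \<open>x a - x b = 2 * t\<close>. The potential \<open>x\<close> need not have the shape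
  \<open>(s 0, - s 0, \<dots>)\<close>, but \<open>s k = (x (2 * k) - x (2 * k + 1)) / 2\<close> does the job because the matrix
  is coherent.
\<close>

section \<open>Potentials and the index involution\<close>

text \<open>Unlike in \<open>dbm_dom\<close>, values are arbitrary reals; membership in
  \<open>I\<close> is tracked separately. Potentials telescope along walks, so their existence rules
  out negative cycles.\<close>

definition potential :: "nat \<Rightarrow> (nat \<Rightarrow> real) \<Rightarrow> ematrix \<Rightarrow> bool" where
  "potential M v n \<longleftrightarrow> (\<forall>i<M. \<forall>j<M. ereal (v j - v i) \<le> n i j)"

lemma potentialD: "potential M v n \<Longrightarrow> i < M \<Longrightarrow> j < M \<Longrightarrow> ereal (v j - v i) \<le> n i j"
  by (simp add: potential_def)

lemma potential_path:
  assumes "potential M v n" "i < M" "k < M" "j < M"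
  shows "ereal (v j - v i) \<le> n i k + n k j"
  using add_mono[OF potentialD[OF assms(1,2,3)] potentialD[OF assms(1,3,4)]] by simp

lemma potential_cycle:
  assumes "potential M v n" "k < M" "l < M"
  shows "0 \<le> n k l + n l k"
  using potential_path[OF assms(1,2,3,2)] by (simp add: zero_ereal_def)

lemma bar_double [simp]: "bar (2 * k) = Suc (2 * k)" "bar (Suc (2 * k)) = 2 * k"
  by (simp_all add: bar_def xor_one_eq xor_Suc_0_eq)

lemma bar_cases:
  obtains k where "i = 2 * k" "bar i = Suc (2 * k)" | k where "i = Suc (2 * k)" "bar i = 2 * k"
  by (metis bar_double oddE evenE Suc_eq_plus1)

lemma bar_less: "i < 2 * N \<Longrightarrow> bar i < 2 * N"
  by (cases i rule: bar_cases) auto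

lemma signed_double_bar:
  "i < 2 * N \<Longrightarrow> signed_double N s (bar i) = - signed_double N s i"
  by (cases i rule: bar_cases) (auto simp: signed_double_def)

subsection \<open>Soundness of the strong closure\<close>

lemma potential_C_step:
  assumes "potential M v n" "k < M" "bar k < M"
  shows "potential M v (C_step k n)"
  unfolding potential_def
proof (intro allI impI)
  fix i j assume ij: "i < M" "j < M"
  have "ereal (v j - v i) \<le> n i k + n k (bar k) + n (bar k) j"
    using add_mono[OF potential_path[OF assms(1) ij(1) assms(2,3)] potentialD[OF assms(1,3) ij(2)]]
    by simp
  moreover have "ereal (v j - v i) \<le> n i (bar k) + n (bar k) k + n k j"
    using add_mono[OF potential_path[OF assms(1) ij(1) assms(3,2)] potentialD[OF assms(1,2) ij(2)]]
    by simp
  ultimately show "ereal (v j - v i) \<le> C_step k n i j"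
    using potentialD[OF assms(1) ij] potential_path[OF assms(1) ij(1) assms(2) ij(2)]
      potential_path[OF assms(1) ij(1) assms(3) ij(2)]
    by (simp add: C_step_def)
qed

text \<open>Antisymmetry under \<open>bar\<close> turns the entries at \<open>(i, bar i)\<close> and
  \<open>(bar j, j)\<close> into bounds on \<open>- 2 * v i\<close> and \<open>2 * v j\<close>,
  whose mean bounds \<open>v j - v i\<close>.\<close>

lemma potential_S_step:
  assumes "potential (2 * N) v n" and "\<And>i. i < 2 * N \<Longrightarrow> v (bar i) = - v i"
  shows "potential (2 * N) v (S_step n)"
  unfolding potential_def
proof (intro allI impI)
  fix i j assume ij: "i < 2 * N" "j < 2 * N"
  have "ereal (- 2 * v i) \<le> n i (bar i)" "ereal (2 * v j) \<le> n (bar j) j"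
    using potentialD[OF assms(1), of i "bar i"] potentialD[OF assms(1), of "bar j" j]
      ij bar_less assms(2) by simp_all
  then have "ereal (v j - v i) \<le> (n i (bar i) + n (bar j) j) / 2"
    by (cases "n i (bar i)"; cases "n (bar j) j") (auto simp: field_simps)
  then show "ereal (v j - v i) \<le> S_step n i j"
    using potentialD[OF assms(1) ij] by (simp add: S_step_def)
qed

lemma potential_closure_iter:
  assumes "potential (2 * N) v m" and "\<And>i. i < 2 * N \<Longrightarrow> v (bar i) = - v i" and "k \<le> N"
  shows "potential (2 * N) v (closure_iter m k)"
  using assms(3)
  by (induction k) (auto intro!: assms potential_S_step potential_C_step)

subsection \<open>Shortest-path closure\<close>

text \<open>In contrast to \<open>C_step\<close>, there is a single pivot and the diagonal is not
  reset: a zero diagonal persists because cycles are nonnegative.\<close>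

definition relax :: "nat \<Rightarrow> ematrix \<Rightarrow> ematrix" where
  "relax k n = (\<lambda>i j. min (n i j) (n i k + n k j))"

primrec fw_iter :: "ematrix \<Rightarrow> nat \<Rightarrow> ematrix" where
  "fw_iter n 0 = n"
| "fw_iter n (Suc k) = relax k (fw_iter n k)"

lemma potential_relax:
  assumes "potential M v n" "k < M"
  shows "potential M v (relax k n)"
  unfolding potential_def relax_def
  using potentialD[OF assms(1)] potential_path[OF assms(1) _ assms(2)] by simp

lemma potential_fw_iter: "potential M v n \<Longrightarrow> k \<le> M \<Longrightarrow> potential M v (fw_iter n k)"
  by (induction k) (auto intro: potential_relax)

lemma relax_diag:
  assumes "potential M v n" "k < M" "i < M" "n i i = 0"
  shows "relax k n i i = 0"
  using potential_cycle[OF assms(1,3,2)] assms(4) by (simp add: relax_def)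

lemma fw_iter_diag:
  assumes "potential M v n" "k \<le> M" "i < M" "n i i = 0"
  shows "fw_iter n k i i = 0"
  using assms(2)
  by (induction k) (auto simp: assms(4) intro: relax_diag[OF potential_fw_iter[OF assms(1)]] assms(3))

lemma fw_iter_le: "fw_iter n k i j \<le> n i j"
  by (induction k) (auto simp: relax_def min.coboundedI1)

text \<open>Finite path weights stay in \<open>I\<close>, so that the potential later built from
  them takes values in \<open>I\<close>.\<close>

lemma dbm_relax:
  assumes "dbm I M n" "k < M" and "\<And>x y. x \<in> I \<Longrightarrow> y \<in> I \<Longrightarrow> x + y \<in> I"
  shows "dbm I M (relax k n)"
  unfolding dbm_def
proof (intro allI impI)
  fix i j assume "i < M" "j < M"
  then have *: "n i j \<in> ereal ` I \<union> {\<infinity>}" "n i k \<in> ereal ` I \<union> {\<infinity>}" "n k j \<in> ereal ` I \<union> {\<infinity>}"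
    using assms(1,2) by (auto simp: dbm_def)
  then have "n i k + n k j \<in> ereal ` I \<union> {\<infinity>}"
    using assms(3) by auto
  with * show "relax k n i j \<in> ereal ` I \<union> {\<infinity>}"
    unfolding relax_def min_def by presburger
qed

lemma dbm_fw_iter:
  assumes "dbm I M n" "k \<le> M" and "\<And>x y. x \<in> I \<Longrightarrow> y \<in> I \<Longrightarrow> x + y \<in> I"
  shows "dbm I M (fw_iter n k)"
  using assms(2) by (induction k) (auto intro: dbm_relax assms)

text \<open>For \<open>l < k\<close>, expanding both minima on the right gives four walks from
  \<open>i\<close> to \<open>j\<close>. In three of them \<open>tri\<close> cuts out
  \<open>l\<close>; the one visiting \<open>k\<close> twice loses the nonnegative cycle
  \<open>k\<close>, \<open>l\<close>, \<open>k\<close>.\<close>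

lemma relax_triangle:
  assumes pot: "potential M v n" and diag: "\<And>i. i < M \<Longrightarrow> n i i = 0" and "k < M"
    and tri: "\<And>i j l. i < M \<Longrightarrow> j < M \<Longrightarrow> l < k \<Longrightarrow> n i j \<le> n i l + n l j"
    and "i < M" "j < M" "l \<le> k"
  shows "relax k n i j \<le> relax k n i l + relax k n l j"
proof (cases "l = k")
  case True
  \<comment> \<open>A zero diagonal leaves the row and column of the pivot unchanged.\<close>
  have "relax k n i k = n i k" "relax k n k j = n k j"
    using diag[OF \<open>k < M\<close>] by (simp_all add: relax_def)
  then show ?thesis
    using True by (simp add: relax_def)
next
  case False
  then have l: "l < k" "l < M" using assms by auto
  have le: "relax k n i j \<le> n i j" "relax k n i j \<le> n i k + n k j"
    by (simp_all add: relax_def)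
  have "relax k n i j \<le> n i l + n l j"
    using le(1) tri[of i j l] assms l by (meson order_trans)
  moreover have "relax k n i j \<le> n i l + (n l k + n k j)"
    using add_right_mono[OF tri[of i k l], of "n k j"] le(2) assms l
    by (auto simp: add.assoc intro: order_trans)
  moreover have "relax k n i j \<le> n i k + n k l + n l j"
    using add_left_mono[OF tri[of k j l], of "n i k"] le(2) assms l
    by (auto simp: add.assoc intro: order_trans)
  moreover have "relax k n i j \<le> n i k + n k l + (n l k + n k j)"
  proof -
    have "n i k + (0 + n k j) \<le> n i k + ((n k l + n l k) + n k j)"
      by (intro add_left_mono add_right_mono potential_cycle[OF pot \<open>k < M\<close> l(2)])
    then show ?thesis
      using le(2) by (auto simp: add.assoc intro: order_trans)
  qed
  ultimately show ?thesis
    by (simp add: relax_def[of k n] min_def[of "n i l"] min_def[of "n l j"])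
qed

lemma fw_iter_triangle:
  assumes pot: "potential M v n" and diag: "\<And>i. i < M \<Longrightarrow> n i i = 0"
    and "k \<le> M" "i < M" "j < M" "l < k"
  shows "fw_iter n k i j \<le> fw_iter n k i l + fw_iter n k l j"
  using assms(3-)
proof (induction k arbitrary: i j l)
  case (Suc k)
  have "relax k (fw_iter n k) i j \<le> relax k (fw_iter n k) i l + relax k (fw_iter n k) l j"
    using Suc by (intro relax_triangle[where M = M and v = v])
      (auto intro: potential_fw_iter pot fw_iter_diag[OF pot] diag)
  then show ?case by simp
qed simp

section \<open>Comparison of the strong closure with the shortest-path closure\<close>

lemma C_step_le:
  assumes "i \<noteq> j"
  shows "C_step k n i j \<le> n i j"
    and "C_step k n i j \<le> n i k + n k j"
    and "C_step k n i j \<le> n i (bar k) + n (bar k) j"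
    and "C_step k n i j \<le> n i k + n k (bar k) + n (bar k) j"
    and "C_step k n i j \<le> n i (bar k) + n (bar k) k + n k j"
  using assms by (simp_all add: C_step_def min_le_iff_disj)

text \<open>
  Diagonal entries are excluded on the left because those of the input matrix of the closure
  algorithm may be positive.
\<close>

lemma C_step_le_relax_relax:
  assumes pot: "potential M v n'" and diag: "\<And>i. i < M \<Longrightarrow> n' i i = 0"
    and le: "\<And>i j. i < M \<Longrightarrow> j < M \<Longrightarrow> i \<noteq> j \<Longrightarrow> n i j \<le> n' i j"
    and k: "k < M" "bar k < M" "bar k \<noteq> k"
    and ij: "i < M" "j < M" "i \<noteq> j"
  shows "C_step k n i j \<le> relax (bar k) (relax k n') i j"
proof -
  let ?q = "bar k" and ?C = "C_step k n i j"
  note C = C_step_le[OF ij(3), of k n]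
  have 1: "?C \<le> n' i j"
    using C(1) le[OF ij] by (rule order_trans)
  \<comment> \<open>A pivot equal to an endpoint would involve a diagonal entry of \<open>n\<close>,
    on which \<open>le\<close> is silent; the zero diagonal of \<open>n'\<close> reduces this case
    to the direct entry.\<close>
  have path: "?C \<le> n' i l + n' l j" if l: "l = k \<or> l = ?q" for l
  proof (cases "l = i \<or> l = j")
    case True
    then show ?thesis using 1 diag ij by auto
  next
    case False
    then have "n i l + n l j \<le> n' i l + n' l j"
      using le ij k l by (intro add_mono) auto
    then show ?thesis using C(2,3) l by (auto intro: order_trans)
  qed
  have path2: "?C \<le> n' i l + n' l l' + n' l' j"
    if l: "l = k \<and> l' = ?q \<or> l = ?q \<and> l' = k" for l l'
  proof (cases "i = l \<or> l' = j")
    case True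
    then show ?thesis using path[of l] path[of l'] l diag ij by auto
  next
    case il: False
    show ?thesis
    proof (cases "i = l' \<or> l = j")
      case True
      \<comment> \<open>An endpoint is revisited, so the walk is a cycle through both pivots plus
        the direct edge.\<close>
      have cyc: "0 \<le> n' l l' + n' l' l"
        using potential_cycle[OF pot] l k by auto
      from True show ?thesis
      proof
        assume "i = l'"
        then have "0 + n' i j \<le> (n' i l + n' l l') + n' l' j"
          using cyc by (intro add_mono) (simp_all add: add.commute)
        then show ?thesis using 1 by (auto intro: order_trans)
      next
        assume "l = j"
        then have "n' i j + 0 \<le> n' i l + (n' l l' + n' l' j)"
          using cyc by (intro add_mono) simp_all
        then show ?thesis using 1 by (auto simp: add.assoc intro: order_trans)
      qed
    next
      case False
      then have "n i l + n l l' + n l' j \<le> n' i l + n' l l' + n' l' j"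
        using il le ij k l by (intro add_mono) auto
      then show ?thesis using C(4,5) l by (auto intro: order_trans)
    qed
  qed
  \<comment> \<open>Nested relaxation also admits the walk \<open>k\<close>, \<open>bar k\<close>,
    \<open>k\<close>, which is no candidate of \<open>C_step\<close>; dropping its cycle leaves the
    walk through \<open>k\<close>.\<close>
  have "n' i k + (0 + n' k j) \<le> n' i k + ((n' k ?q + n' ?q k) + n' k j)"
    by (intro add_left_mono add_right_mono potential_cycle[OF pot k(1,2)])
  then have 4: "?C \<le> n' i k + n' k ?q + (n' ?q k + n' k j)"
    using path[of k] by (auto simp: add.assoc intro: order_trans)
  show ?thesis
    using 1 4 path[of k] path[of ?q] path2[of k ?q] path2[of ?q k]
    by (simp add: relax_def min_def[of "n' i ?q"] min_def[of "n' ?q j"] add.assoc)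
qed

text \<open>One closure round pivots on both \<open>2 * k\<close> and \<open>2 * k + 1\<close>,
  hence is matched with two relaxations.\<close>

lemma closure_iter_le_fw_iter:
  assumes pot: "potential (2 * N) v n" and diag: "\<And>i. i < 2 * N \<Longrightarrow> n i i = 0"
    and le: "\<And>i j. i < 2 * N \<Longrightarrow> j < 2 * N \<Longrightarrow> i \<noteq> j \<Longrightarrow> m i j \<le> n i j"
    and "k \<le> N" "i < 2 * N" "j < 2 * N" "i \<noteq> j"
  shows "closure_iter m k i j \<le> fw_iter n (2 * k) i j"
  using assms(4-)
proof (induction k arbitrary: i j)
  case (Suc k)
  have "closure_iter m (Suc k) i j \<le> C_step (2 * k) (closure_iter m k) i j"
    by (simp add: S_step_def)
  also have "\<dots> \<le> relax (bar (2 * k)) (relax (2 * k) (fw_iter n (2 * k))) i j"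
    using Suc by (intro C_step_le_relax_relax[where M = "2 * N" and v = v])
      (auto intro: potential_fw_iter pot fw_iter_diag[OF pot] diag)
  finally show ?case by simp
qed (simp add: le)

subsection \<open>Attaining a prescribed difference\<close>

text \<open>Shifted rows of \<open>c\<close> obey its constraints by the triangle inequality, and so
  does a minimum of such functions with \<open>v\<close>. The shifts are chosen so that the minimum
  is \<open>min (v a) (v b + d)\<close> at \<open>a\<close> and \<open>min (v b) (v a - d)\<close>
  at \<open>b\<close>, which differ by \<open>d\<close>.\<close>

lemma potential_with_difference:
  assumes cl: "\<And>x y. x \<in> I \<Longrightarrow> y \<in> I \<Longrightarrow> x + y \<in> I" "\<And>x. x \<in> I \<Longrightarrow> - x \<in> I"
    and c: "dbm I M c"
    and diag: "\<And>i. i < M \<Longrightarrow> c i i = 0"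
    and tri: "\<And>i j l. i < M \<Longrightarrow> j < M \<Longrightarrow> l < M \<Longrightarrow> c i j \<le> c i l + c l j"
    and v: "potential M v c" "\<And>i. i < M \<Longrightarrow> v i \<in> I"
    and ab: "a < M" "b < M" and d: "d \<in> I" "ereal d \<le> c b a" "ereal (- d) \<le> c a b"
  obtains x where "potential M x c" "\<And>i. i < M \<Longrightarrow> x i \<in> I" "x a - x b = d"
proof -
  define y where
    "y j = min (ereal (v j)) (min (ereal (v b + d) + c a j) (ereal (v a - d) + c b j))" for j
  \<comment> \<open>The branch \<open>v j\<close> keeps the minimum finite even where
    \<open>c\<close> is infinite.\<close>
  have "y j \<in> ereal ` I" if j: "j < M" for j
  proof -
    have sh: "ereal r + c l j \<in> ereal ` I \<union> {\<infinity>}" if "r \<in> I" "l < M" for r l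
    proof -
      have "c l j \<in> ereal ` I \<union> {\<infinity>}" using c j that by (auto simp: dbm_def)
      then show ?thesis using cl(1) that by auto
    qed
    have "ereal (v b + d) + c a j \<in> ereal ` I \<union> {\<infinity>}" "ereal (v a - d) + c b j \<in> ereal ` I \<union> {\<infinity>}"
      using sh[of "v b + d" a] sh[of "v a - d" b] cl(1)[of "v a" "- d"] cl v(2) ab d by auto
    moreover have "ereal (v j) \<in> ereal ` I" using v(2) j by simp
    ultimately show ?thesis unfolding y_def min_def by auto
  qed
  then obtain x where x: "\<And>j. j < M \<Longrightarrow> x j \<in> I" "\<And>j. j < M \<Longrightarrow> y j = ereal (x j)"
    unfolding image_iff Bex_def by metis
  have "y j \<le> y l + c l j" if l: "l < M" and j: "j < M" for l j
  proof -
    have "ereal (v j) \<le> ereal (v l) + c l j"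
      using potentialD[OF v(1) l j] by (cases "c l j") auto
    moreover have "ereal r + c e j \<le> ereal r + c e l + c l j" if "e < M" for r e
      using tri[OF that j l] by (simp add: add.assoc add_left_mono)
    ultimately show ?thesis
      using ab unfolding y_def min_def[of "ereal (v l)"] min_def[of "ereal (v b + d) + c a l"]
      by (auto intro: min.coboundedI1 min.coboundedI2)
  qed
  then have "potential M x c"
    unfolding potential_def
  proof (intro allI impI)
    fix l j assume lj: "l < M" "j < M"
    then have "ereal (x j) \<le> ereal (x l) + c l j"
      using \<open>\<And>l j. l < M \<Longrightarrow> j < M \<Longrightarrow> y j \<le> y l + c l j\<close>[OF lj] x(2) by simp
    then show "ereal (x j - x l) \<le> c l j"
      by (cases "c l j") auto
  qed
  moreover have "x a - x b = d"
  proof (rule antisym)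
    have le: "y a \<le> ereal (v a)" "y a \<le> ereal (v b + d)"
      "y b \<le> ereal (v b)" "y b \<le> ereal (v a - d)"
      using diag ab by (simp_all add: y_def min_le_iff_disj)
    have "y b = ereal (v b) \<or> y b = ereal (v b + d) + c a b \<or> y b = ereal (v a - d)"
      using diag ab by (auto simp: y_def min_def)
    moreover have "ereal (v b) \<le> ereal (v b + d) + c a b"
      using d(3) by (cases "c a b") auto
    ultimately have "ereal (v b) \<le> y b \<or> y b = ereal (v a - d)" by auto
    then show "x a - x b \<le> d"
      using le(1,2) x(2) ab by auto
    have "y a = ereal (v a) \<or> y a = ereal (v b + d) \<or> y a = ereal (v a - d) + c b a"
      using diag ab by (auto simp: y_def min_def)
    moreover have "ereal (v a) \<le> ereal (v a - d) + c b a"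
      using d(2) by (cases "c b a") auto
    ultimately have "ereal (v a) \<le> y a \<or> y a = ereal (v b + d)" by auto
    then show "d \<le> x a - x b"
      using le(3,4) x(2) ab by auto
  qed
  ultimately show ?thesis using that x(1) by blast
qed

text \<open>By coherence, sending \<open>i\<close> to \<open>- x (bar i)\<close> is again a
  potential of \<open>m\<close>. The signed double of the tuple is the mean of this potential and
  \<open>x\<close>, and potentials form a convex set.\<close>

lemma symmetrized_in_oct_dom:
  assumes coh: "coherent N m" and pot: "potential (2 * N) x m"
    and I: "\<And>k. k < N \<Longrightarrow> (x (2 * k) - x (2 * k + 1)) / 2 \<in> I" "\<And>x. x \<in> I \<Longrightarrow> - x \<in> I"
  shows "(\<lambda>k\<in>{..<N}. (x (2 * k) - x (2 * k + 1)) / 2) \<in> oct_dom I N m" (is "?s \<in> _")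
proof -
  have sd: "signed_double N ?s i = (x i - x (bar i)) / 2" if "i < 2 * N" for i
    using that by (cases i rule: bar_cases) (auto simp: signed_double_def field_simps)
  have "ereal (signed_double N ?s j - signed_double N ?s i) \<le> m i j"
    if ij: "i < 2 * N" "j < 2 * N" for i j
  proof -
    have "m (bar j) (bar i) = m i j"
      using coh ij by (simp add: coherent_def)
    then have "ereal (x (bar i) - x (bar j)) \<le> m i j"
      using potentialD[OF pot, of "bar j" "bar i"] ij bar_less by simp
    with potentialD[OF pot ij] show ?thesis
      unfolding sd[OF ij(1)] sd[OF ij(2)] by (cases "m i j") (auto simp: field_simps)
  qed
  moreover have "signed_double N ?s \<in> {..<2 * N} \<rightarrow>\<^sub>E I"
  proof
    fix i assume "i \<in> {..<2 * N}"
    then show "signed_double N ?s i \<in> I"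
      using I by (cases i rule: bar_cases) (auto simp: signed_double_def)
  qed (simp add: signed_double_def)
  ultimately show ?thesis
    using I(1) by (auto simp: oct_dom_def dbm_dom_def)
qed

theorem theorem6:
  fixes I :: "real set" and N :: nat and m :: ematrix and i :: nat
  assumes "I \<in> {\<rat>, \<real>}"
    and "N \<ge> 1"
    and "dbm I (2*N) m"
    and "coherent N m"
    and "oct_dom I N m \<noteq> {}"
    and "i < N"
  shows "{t \<in> I. \<exists>s \<in> oct_dom I N m. s i = t} =
         {t \<in> I. ereal t \<in> {- strong_closure N m (2*i) (2*i+1) / 2 ..
                             strong_closure N m (2*i+1) (2*i) / 2}}"
proof -
  let ?a = "2 * i" and ?b = "2 * i + 1"
  let ?c = "strong_closure N m"
  have ab: "?a < 2 * N" "?b < 2 * N" using assms(6) by auto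
  have cl: "\<And>x y. x \<in> I \<Longrightarrow> y \<in> I \<Longrightarrow> x + y \<in> I" "\<And>x. x \<in> I \<Longrightarrow> - x \<in> I"
      "\<And>x. x \<in> I \<Longrightarrow> x / 2 \<in> I" "0 \<in> I"
    using assms(1) by (auto simp: Reals_def)
  \<comment> \<open>Since \<open>t\<close> is real, a bound with entry \<infinity> imposes no
    condition.\<close>
  have interval: "ereal t \<in> {- ?c ?a ?b / 2 .. ?c ?b ?a / 2} \<longleftrightarrow>
      ereal (2 * t) \<le> ?c ?b ?a \<and> ereal (- (2 * t)) \<le> ?c ?a ?b" for t
    by (cases "?c ?a ?b"; cases "?c ?b ?a") (auto simp: field_simps)
  have oct_pot: "potential (2 * N) (signed_double N s) m" if "s \<in> oct_dom I N m" for s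
    using that by (auto simp: oct_dom_def dbm_dom_def potential_def)
  have "ereal (s i) \<in> {- ?c ?a ?b / 2 .. ?c ?b ?a / 2}" if s: "s \<in> oct_dom I N m" for s
  proof -
    have "potential (2 * N) (signed_double N s) ?c"
      unfolding strong_closure_def
      by (rule potential_closure_iter[OF oct_pot[OF s]]) (simp_all add: signed_double_bar)
    from potentialD[OF this ab] potentialD[OF this ab(2,1)] show ?thesis
      using assms(6) unfolding interval by (simp add: signed_double_def)
  qed
  moreover have "\<exists>s \<in> oct_dom I N m. s i = t"
    if t: "t \<in> I" "ereal t \<in> {- ?c ?a ?b / 2 .. ?c ?b ?a / 2}" for t
  proof -
    obtain s0 where s0: "s0 \<in> oct_dom I N m" using assms(5) by blast
    define v where "v = signed_double N s0"
    have vI: "v k \<in> I" if "k < 2 * N" for k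
      using s0 that by (auto simp: v_def oct_dom_def dbm_dom_def)
    have vm: "potential (2 * N) v m"
      unfolding v_def by (rule oct_pot[OF s0])
    \<comment> \<open>The diagonal of \<open>m\<close> may be positive, while the shortest-path
      argument needs it to be zero.\<close>
    define n where "n = (\<lambda>k l. if k = l then 0 else m k l)"
    have vn: "potential (2 * N) v n"
      using vm by (simp add: potential_def n_def)
    have n_diag: "n k k = 0" for k by (simp add: n_def)
    define c where "c = fw_iter n (2 * N)"
    have "dbm I (2 * N) n"
      using assms(3) cl(4) by (auto simp: dbm_def n_def zero_ereal_def)
    then have c_dbm: "dbm I (2 * N) c"
      unfolding c_def by (rule dbm_fw_iter) (auto intro: cl)
    have c_diag: "c k k = 0" if "k < 2 * N" for k
      unfolding c_def by (rule fw_iter_diag[OF vn order_refl that n_diag])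
    have c_tri: "c j k \<le> c j l + c l k" if "j < 2 * N" "k < 2 * N" "l < 2 * N" for j k l
      unfolding c_def by (rule fw_iter_triangle[OF vn n_diag order_refl that])
    have c_pot: "potential (2 * N) v c"
      unfolding c_def by (rule potential_fw_iter[OF vn order_refl])
    have c_ge: "?c k l \<le> c k l" if "k < 2 * N" "l < 2 * N" "k \<noteq> l" for k l
      unfolding c_def strong_closure_def
      using that by (intro closure_iter_le_fw_iter[OF vn]) (auto simp: n_def)
    have d: "ereal (2 * t) \<le> c ?b ?a" "ereal (- (2 * t)) \<le> c ?a ?b"
      using t(2) c_ge[OF ab] c_ge[OF ab(2,1)] unfolding interval by (auto intro: order_trans)
    have "2 * t \<in> I" using cl(1)[OF t(1) t(1)] by simp
    then obtain x where x: "potential (2 * N) x c" "\<And>k. k < 2 * N \<Longrightarrow> x k \<in> I" "x ?a - x ?b = 2 * t"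
      using potential_with_difference[OF cl(1,2) c_dbm c_diag c_tri c_pot vI ab _ d] by blast
    have "ereal (x l - x k) \<le> m k l" if kl: "k < 2 * N" "l < 2 * N" for k l
    proof (cases "k = l")
      \<comment> \<open>Resetting the diagonal lost the entry \<open>m k k\<close>; its
        nonnegativity comes from the original potential \<open>v\<close>.\<close>
      case True
      then show ?thesis using potentialD[OF vm kl] by simp
    next
      case False
      then show ?thesis
        using potentialD[OF x(1) kl] fw_iter_le[of n "2 * N" k l]
        by (auto simp: c_def n_def intro: order_trans)
    qed
    then have "potential (2 * N) x m" by (simp add: potential_def)
    \<comment> \<open>Here closure of \<open>I\<close> under halving is essential; it would fail for
      the integers.\<close>
    moreover have "(x (2 * k) - x (2 * k + 1)) / 2 \<in> I" if "k < N" for k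
      using x(2)[of "2 * k"] x(2)[of "2 * k + 1"] that cl(1)[of "x (2 * k)" "- x (2 * k + 1)"] cl by auto
    ultimately have "(\<lambda>k\<in>{..<N}. (x (2 * k) - x (2 * k + 1)) / 2) \<in> oct_dom I N m"
      using assms(4) cl(2) by (intro symmetrized_in_oct_dom) auto
    then show ?thesis
      by (rule rev_bexI) (use x(3) assms(6) in simp)
  qed
  ultimately show ?thesis by auto
qed

end
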